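(* Let $R$ be a finite commutative ring with identity with Artin decomposition $R\simeq R_1\times\cdots\times R_s$, where each $R_i$ is a local ring with maximal ideal $\mathfrak{m}_i$ and residue field $R_i/\mathfrak{m}_i\simeq\mathbb{F}_{q_i}$. Let $k\in\mathbb{N}$ be such that $\gcd(k,|R|)=1$. Then: (a) $G_R(k)$ is bipartite if and only if there is some index $i\in\{1,\dots,s\}$ such that $$G_{\mathbb{F}_{q_i}}(k)=\Gamma(2^{t_i}-1,2^{t_i})\simeq K_2\sqcup\cdots\sqcup K_2\quad(2^{t_i-1}\text{ copies}).$$ (b) If further there is at most one index $j\in\{1,\dots,s\}$ such that $-1\notin U_{R_j,k}$, then $\mathcal{G}_R(k)$ is bipartite if and only if there is some index $i\in\{1,\dots,s\}$ such that $$\mathcal{G}_{\mathbb{F}_{q_i}}(k)=\Gamma(2^{t_i}-1,2^{t_i})\simeq K_2\sqcup\cdots\sqcup K_2\quad(2^{t_i-1}\text{ copies}).$$ In both items, $q_i=2^{t_i}$ and $\gcd(k,q_i-1)=2^{t_i}-1$.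
   Context: For a commutative ring $R$ with identity and a positive integer $k$, $R^*$ is the group of units, $U_{R,k}=\{x^k:x\in R^*\}$ and $T_{R,k}=U_{R,k}\cup(-U_{R,k})$. For an abelian group $A$ and $S\subseteq A$ with $0\notin S$, $X(A,S)$ denotes the Cayley digraph with vertex set $A$ and an arc from $v$ to $w$ iff $w-v\in S$; it is undirected if $S=-S$ and directed otherwise. Define $G_R(k)=X(R,U_{R,k})$ and $\mathcal{G}_R(k)=X(R,T_{R,k})$; for a finite field, the generalized Paley graph is $\Gamma(k,q)=X(\mathbb{F}_q,\{x^k:x\in\mathbb{F}_q^*\})=G_{\mathbb{F}_q}(k)$. A graph or digraph is bipartite if its vertex set is a disjoint union $V_1\cup V_2$ such that every edge (arc) joins a vertex of $V_1$ with a vertex of $V_2$ (in either direction). $\sqcup$ denotes disjoint union of graphs and $K_2$ is the complete graph on two vertices. *)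

theory Defs
  imports
    "HOL-Algebra.Chinese_Remainder"
    "Graph_Theory.Graph_Theory"
begin

section \<open>Rings\<close>

definition local_cring :: "('a, 'm) ring_scheme \<Rightarrow> 'a set \<Rightarrow> bool" where
  "local_cring R \<mm> \<longleftrightarrow>
     cring R \<and> maximalideal \<mm> R \<and> (\<forall>I. maximalideal I R \<longrightarrow> I = \<mm>)"

definition U_set :: "('a, 'm) ring_scheme \<Rightarrow> nat \<Rightarrow> 'a set" where
  "U_set R k = {x [^]\<^bsub>R\<^esub> k | x. x \<in> Units R}"

definition T_set :: "('a, 'm) ring_scheme \<Rightarrow> nat \<Rightarrow> 'a set" where
  "T_set R k = U_set R k \<union> {\<ominus>\<^bsub>R\<^esub> u | u. u \<in> U_set R k}"

text \<open>A fixed model of the field with \<open>q\<close> elements, with underlying set in \<^typ>\<open>nat\<close>.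
  It is meaningful only when \<open>q\<close> is a prime power.\<close>

definition GF :: "nat \<Rightarrow> nat ring" where
  "GF q = (SOME F. field F \<and> finite (carrier F) \<and> card (carrier F) = q)"

lemma GF_field:
  assumes "field (F :: ('a, 'm) ring_scheme)" and "finite (carrier F)"
  shows "field (GF (card (carrier F)))"
    and "finite (carrier (GF (card (carrier F))))"
    and "card (carrier (GF (card (carrier F)))) = card (carrier F)"
proof -
  obtain f :: "'a \<Rightarrow> nat" where f: "inj_on f (carrier F)"
    using finite_imp_inj_to_nat_seg[OF assms(2)] by metis
  have "field (image_ring f F)"
    using field.inj_imp_image_ring_is_field[OF assms(1) f] .
  moreover have "carrier (image_ring f F) = f ` carrier F"
    by (rule image_ring_carrier)
  ultimately have "\<exists>K :: nat ring. field K \<and> finite (carrier K) \<and>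
      card (carrier K) = card (carrier F)"
    using assms(2) card_image[OF f] by (metis finite_imageI)
  from someI_ex[OF this, folded GF_def]
  show "field (GF (card (carrier F)))"
    and "finite (carrier (GF (card (carrier F))))"
    and "card (carrier (GF (card (carrier F)))) = card (carrier F)"
    by blast+
qed

section \<open>Graphs\<close>

text \<open>Digraphs are pair digraphs; an undirected graph is one with symmetric arc relation, each
  edge being a pair of opposite arcs. The abelian group is written multiplicatively, so
  \<open>w - v\<close> becomes \<open>w \<otimes> inv v\<close>; it is used with \<^const>\<open>add_monoid\<close> of a ring.\<close>

definition cayley_digraph :: "('a, 'm) monoid_scheme \<Rightarrow> 'a set \<Rightarrow> 'a pair_pre_digraph" where
  "cayley_digraph A S =
     \<lparr> pverts = carrier A,
       parcs = {(v, w). v \<in> carrier A \<and> w \<in> carrier A \<and> w \<otimes>\<^bsub>A\<^esub> inv\<^bsub>A\<^esub> v \<in> S} \<rparr>"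

definition G_graph :: "('a, 'm) ring_scheme \<Rightarrow> nat \<Rightarrow> 'a pair_pre_digraph" where
  "G_graph R k = cayley_digraph (add_monoid R) (U_set R k)"

definition GT_graph :: "('a, 'm) ring_scheme \<Rightarrow> nat \<Rightarrow> 'a pair_pre_digraph" where
  "GT_graph R k = cayley_digraph (add_monoid R) (T_set R k)"

definition gen_paley :: "nat \<Rightarrow> nat \<Rightarrow> nat pair_pre_digraph" where
  "gen_paley k q = cayley_digraph (add_monoid (GF q))
     {x [^]\<^bsub>GF q\<^esub> k | x. x \<in> carrier (GF q) - {\<zero>\<^bsub>GF q\<^esub>}}"

definition bipartite :: "'a pair_pre_digraph \<Rightarrow> bool" where
  "bipartite G \<longleftrightarrow> (\<exists>V1 V2. V1 \<inter> V2 = {} \<and> V1 \<union> V2 = pverts G \<and>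
     parcs G \<subseteq> V1 \<times> V2 \<union> V2 \<times> V1)"

definition complete_graph :: "nat \<Rightarrow> nat pair_pre_digraph" where
  "complete_graph n = \<lparr> pverts = {..<n}, parcs = {(u, v). u < n \<and> v < n \<and> u \<noteq> v} \<rparr>"

definition disjoint_copies :: "nat \<Rightarrow> 'a pair_pre_digraph \<Rightarrow> (nat \<times> 'a) pair_pre_digraph" where
  "disjoint_copies n G =
     \<lparr> pverts = {..<n} \<times> pverts G,
       parcs = {((i, u), (i, v)) | i u v. i < n \<and> (u, v) \<in> parcs G} \<rparr>"

end

theory Submission
  imports Defs "HOL-Algebra.Multiplicative_Group" "HOL-Algebra.Sylow"
begin

text \<open>Bipartiteness only sees arcs up to reversal, and \<open>\<G>\<^sub>R(k)\<close> arises from \<open>G\<^sub>R(k)\<close> by adding the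
reversed arcs. So one graph is bipartite exactly when the other is
(\<open>bipartite_GT_graph_iff\<close>), and both parts come down to \<open>G\<^sub>R(k)\<close>.

Call a local factor with residue field \<open>K\<close> of order \<open>q\<close> \<^emph>\<open>trivialising\<close> if \<open>K\<close> has characteristic two
and every nonzero \<open>a \<in> K\<close> satisfies \<open>a\<^sup>k = 1\<close>. A field of characteristic two has order \<open>2\<^sup>t\<close>, and
comparing the \<open>q - 1\<close> nonzero elements with the number of roots of a polynomial \<open>X\<^sup>d - 1\<close> turns the
second condition into \<open>q - 1\<close> dividing \<open>k\<close> (\<open>power_of_two_card_and_dvd_iff\<close>). In
a field of characteristic two, where signs do not matter, the second condition says that the
connection set shrinks to \<open>{1}\<close>; the Cayley graph is then the perfect matching \<open>v \<mapsto> v + 1\<close>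
(\<open>cayley_eq_gen_paley_iff\<close>). So it has to be shown that \<open>G\<^sub>R(k)\<close> is bipartite if
and only if some factor is trivialising (\<open>bipartite_G_graph_iff\<close>).

If a factor is trivialising, the projection from \<open>R\<close> to its residue field \<open>K\<close> sends every \<open>k\<close>-th power
of a unit to \<open>1\<close>. It is a graph homomorphism from \<open>G\<^sub>R(k)\<close> to the matching on \<open>K\<close>, and a two-colouring
of the matching pulls back (\<open>bipartite_if_hom_to_char_two_field\<close>).

If no factor is trivialising, there is a closed walk of odd length. For a \<open>k\<close>-th power \<open>u\<close> of a unit,
the partial sums of \<open>1 + u + u\<^sup>2 + \<dots>\<close> form a directed walk from \<open>0\<close>, since the powers of \<open>u\<close> are again
\<open>k\<close>-th powers of units. In each local factor one can choose \<open>u\<close> and an odd \<open>n\<close> such that \<open>u\<^sup>n = 1\<close> and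
the sum of the first \<open>n\<close> powers is zero (\<open>odd_vanishing_geometric_sum\<close>). The
lengths of these walks differ, but since \<open>u\<^sup>n = 1\<close> the sum of the first \<open>N\<close> powers vanishes for every
multiple \<open>N\<close> of \<open>n\<close>. Taking for \<open>N\<close> the product of all the \<open>n\<close> gives one odd closed walk in the direct
product, hence in \<open>R\<close>.\<close>

text \<open>The infix \<open>\<oplus>\<close> is freed from its meaning for vertex walks, so that it denotes ring addition only.\<close>

no_notation vwalk_join (infixl "\<oplus>" 65)

section \<open>Perfect matchings\<close>

text \<open>Both the two-colouring of a matching and its isomorphism with copies of \<open>K\<^sub>2\<close> start from a choice of
one point in every orbit of a fixed-point-free involution.\<close>

lemma involution_transversal:
  assumes "\<And>a. a \<in> A \<Longrightarrow> \<sigma> (\<sigma> a) = a" and "\<And>a. a \<in> A \<Longrightarrow> \<sigma> a \<noteq> a"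
  obtains C where "C \<subseteq> A" "\<And>a. a \<in> A \<Longrightarrow> \<sigma> a \<in> A \<Longrightarrow> \<sigma> a \<in> C \<longleftrightarrow> a \<notin> C"
proof
  \<comment> \<open>Both points of an orbit choose the same representative, because the choice is made from the
    orbit as an unordered pair.\<close>
  define c where "c a = (SOME x. x \<in> {a, \<sigma> a})" for a
  have mem: "c a \<in> {a, \<sigma> a}" for a
    unfolding c_def by (rule someI[of _ a]) simp
  have inv: "c (\<sigma> a) = c a" if "a \<in> A" for a
    unfolding c_def using assms(1)[OF that] by (simp add: insert_commute)
  show "{a \<in> A. c a = a} \<subseteq> A" by blast
  show "\<sigma> a \<in> {a \<in> A. c a = a} \<longleftrightarrow> a \<notin> {a \<in> A. c a = a}" if "a \<in> A" "\<sigma> a \<in> A" for a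
    using that mem[of a] inv[OF that(1)] assms(2)[OF that(1)] by auto
qed

lemma digraph_iso_with_projI:
  assumes "pair_wf_digraph G" and "bij_betw f (pverts G) (pverts H)"
    and "parcs H = map_prod f f ` parcs G"
  shows "digraph_iso (with_proj G) (with_proj H)"
proof -
  interpret pair_wf_digraph G by fact
  let ?\<phi> = "\<lparr>iso_verts = f, iso_arcs = map_prod f f, iso_head = snd, iso_tail = fst\<rparr>"
  have inj: "inj_on f (pverts G)" and img: "f ` pverts G = pverts H"
    using assms(2) by (auto simp: bij_betw_def)
  have "parcs G \<subseteq> pverts G \<times> pverts G"
    using in_arcsD1 in_arcsD2 by auto
  then have "inj_on (map_prod f f) (parcs G)"
    using map_prod_inj_on[OF inj inj] by (metis inj_on_subset)
  then have "pre_digraph.digraph_isomorphism (with_proj G) ?\<phi>"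
    using inj by (simp add: pre_digraph.digraph_isomorphism_def wf_digraph_wp_iff assms(1))
  moreover have "with_proj H = app_iso ?\<phi> (with_proj G)"
    using img assms(3) by (simp add: app_iso_def with_proj_def)
  ultimately show ?thesis
    unfolding digraph_iso_def by blast
qed

lemma digraph_iso_card_verts:
  assumes "digraph_iso G H"
  shows "card (verts G) = card (verts H)"
  using assms unfolding digraph_iso_def pre_digraph.digraph_isomorphism_def
  by (auto simp: card_image)

lemma involution_digraph_iso_copies_K2:
  assumes fin: "finite A" and card: "card A = 2 * n"
    and closed: "\<And>a. a \<in> A \<Longrightarrow> \<sigma> a \<in> A"
    and inv: "\<And>a. a \<in> A \<Longrightarrow> \<sigma> (\<sigma> a) = a" and fixfree: "\<And>a. a \<in> A \<Longrightarrow> \<sigma> a \<noteq> a"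
  shows "digraph_iso (with_proj \<lparr>pverts = A, parcs = {(a, b). a \<in> A \<and> b = \<sigma> a}\<rparr>)
           (with_proj (disjoint_copies n (complete_graph 2)))"
proof -
  obtain C where C: "C \<subseteq> A" "\<And>a. a \<in> A \<Longrightarrow> \<sigma> a \<in> C \<longleftrightarrow> a \<notin> C"
    using involution_transversal[of A \<sigma>, OF inv fixfree] closed by metis
  have D: "\<sigma> ` C = A - C"
  proof
    show "\<sigma> ` C \<subseteq> A - C" using C closed by auto
    show "A - C \<subseteq> \<sigma> ` C"
      using C closed inv by (metis DiffE image_eqI subsetI)
  qed
  have "inj_on \<sigma> C" using C(1) inv by (metis inj_onI subsetD)
  then have "card (A - C) = card C" using D card_image by metis
  then have "card C = n"
    using card card_Diff_subset[OF finite_subset[OF C(1) fin] C(1)] card_mono[OF fin C(1)] by simp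
  then obtain h where h: "bij_betw h C {..<n}"
    using finite_subset[OF C(1) fin] by (metis bij_betw_iff_card card_lessThan finite_lessThan)
  \<comment> \<open>The first coordinate numbers the orbits; the second tells whether the point is the chosen one.\<close>
  define f where "f a = (if a \<in> C then (h a, 0::nat) else (h (\<sigma> a), 1))" for a
  define f' where "f' p = (if snd p = 0 then inv_into C h (fst p) else \<sigma> (inv_into C h (fst p)))"
    for p :: "nat \<times> nat"
  have hC: "h c < n" if "c \<in> C" for c using h that by (auto simp: bij_betw_def)
  have h': "inv_into C h j \<in> C" "h (inv_into C h j) = j" if "j < n" for j
    using h that by (auto simp: bij_betw_def inv_into_into f_inv_into_f)
  have h'h: "inv_into C h (h c) = c" if "c \<in> C" for c
    using h that by (auto simp: bij_betw_def)
  have bij: "bij_betw f A ({..<n} \<times> {..<2})"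
  proof (rule bij_betwI[where g = f'])
    show "f \<in> A \<rightarrow> {..<n} \<times> {..<2}"
      using C hC by (auto simp: f_def)
    show "f' \<in> {..<n} \<times> {..<2} \<rightarrow> A"
      using C(1) h' closed by (auto simp: f'_def subset_iff)
    show "f' (f a) = a" if "a \<in> A" for a
      using C(2)[OF that] inv[OF that] h'h[of a] h'h[of "\<sigma> a"] by (simp add: f_def f'_def)
    show "f (f' p) = p" if p_in: "p \<in> {..<n} \<times> {..<2}" for p
    proof -
      obtain j e where p: "p = (j, e)" "j < n" "e < 2" using p_in by blast
      have j: "inv_into C h j \<in> C" "inv_into C h j \<in> A" using h'(1)[OF p(2)] C(1) by auto
      show ?thesis
        using p h'(2)[OF p(2)] j C(2)[OF j(2)] inv[OF j(2)] by (auto simp: f_def f'_def)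
    qed
  qed
  have f\<sigma>: "f (\<sigma> a) = (fst (f a), 1 - snd (f a))" if "a \<in> A" for a
    using that C(2)[OF that] inv[OF that] by (auto simp: f_def)
  have snd_lt: "fst (f a) < n" "snd (f a) < 2" if "a \<in> A" for a
    using bij_betw_apply[OF bij that] by (auto simp: mem_Times_iff)
  have arcs: "parcs (disjoint_copies n (complete_graph 2))
      = map_prod f f ` {(a, b). a \<in> A \<and> b = \<sigma> a}" (is "?L = ?R")
  proof
    show "?R \<subseteq> ?L"
    proof clarsimp
      fix a assume a: "a \<in> A"
      show "(f a, f (\<sigma> a)) \<in> ?L"
        using snd_lt[OF a] f\<sigma>[OF a]
        by (cases "f a"; cases "snd (f a)") (auto simp: disjoint_copies_def complete_graph_def)
    qed
    show "?L \<subseteq> ?R"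
    proof
      fix e assume "e \<in> ?L"
      then obtain j u v where e: "e = ((j, u), (j, v))" "j < n" "u < 2" "v < 2" "u \<noteq> v"
        by (auto simp: disjoint_copies_def complete_graph_def)
      then have "(j, u) \<in> f ` A" using bij by (auto simp: bij_betw_def)
      then obtain a where a: "a \<in> A" "f a = (j, u)" by (metis imageE)
      then have "f (\<sigma> a) = (j, v)" using f\<sigma>[OF a(1)] e by auto
      then show "e \<in> ?R"
        using a e(1) by (intro image_eqI[of _ _ "(a, \<sigma> a)"]) auto
    qed
  qed
  show ?thesis
  proof (rule digraph_iso_with_projI)
    show "pair_wf_digraph \<lparr>pverts = A, parcs = {(a, b). a \<in> A \<and> b = \<sigma> a}\<rparr>"
      by unfold_locales (auto simp: closed)
    show "bij_betw f (pverts \<lparr>pverts = A, parcs = {(a, b). a \<in> A \<and> b = \<sigma> a}\<rparr>)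
        (pverts (disjoint_copies n (complete_graph 2)))"
      using bij by (simp add: disjoint_copies_def complete_graph_def)
    show "parcs (disjoint_copies n (complete_graph 2))
        = map_prod f f ` parcs \<lparr>pverts = A, parcs = {(a, b). a \<in> A \<and> b = \<sigma> a}\<rparr>"
      using arcs by simp
  qed
qed

section \<open>Finite fields\<close>

context field begin

lemma pow_card_minus_one:
  assumes "finite (carrier R)" "a \<in> carrier R - {\<zero>}"
  shows "a [^] (card (carrier R) - 1) = \<one>"
  using units_power_order_eq_one[OF finite_ring_finite_units[OF assms(1)], of a] assms field_Units
  by (simp add: card_Diff_singleton)

text \<open>If all \<open>q - 1\<close> nonzero elements satisfy \<open>a\<^sup>k = 1\<close>, they are roots of \<open>X\<^sup>d - 1\<close> for
  \<open>d = gcd k (q - 1)\<close>. Such a polynomial has at most \<open>d\<close> roots, so the divisor \<open>d\<close> of \<open>q - 1\<close> is all of it.\<close>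

lemma exponent_of_units:
  assumes fin: "finite (carrier R)"
  shows "(\<forall>a \<in> carrier R - {\<zero>}. a [^] k = \<one>) \<longleftrightarrow> (card (carrier R) - 1) dvd k" (is "?L \<longleftrightarrow> ?R")
proof
  let ?q = "card (carrier R)"
  assume ?R
  then obtain c where "k = (?q - 1) * c" by auto
  moreover have "a [^] ((?q - 1) * c) = \<one>" if "a \<in> carrier R - {\<zero>}" for a
    using pow_card_minus_one[OF fin that] nat_pow_pow[of a "?q - 1" c] that by simp
  ultimately show ?L by blast
next
  let ?q = "card (carrier R)"
  have "card {\<zero>, \<one>} \<le> ?q" by (intro card_mono fin) auto
  then have q: "?q \<ge> 2" by simp
  assume L: ?L
  define d where "d = gcd k (?q - 1)"
  have d0: "d \<noteq> 0" using q by (simp add: d_def)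
  interpret M: group "mult_of R" by (rule field_mult_group)
  have "a [^] d = \<one>" if "a \<in> carrier R - {\<zero>}" for a
  proof -
    have "M.ord a dvd k" "M.ord a dvd ?q - 1"
      using that L pow_card_minus_one[OF fin that]
      by (auto simp: M.pow_eq_id[symmetric] nat_pow_mult_of[symmetric])
    then have "M.ord a dvd d" by (simp add: d_def)
    then show ?thesis using that by (auto simp: M.pow_eq_id[symmetric] nat_pow_mult_of)
  qed
  then have "carrier R - {\<zero>} \<subseteq> {x \<in> carrier R. x [^] d = \<one>}" by auto
  then have "?q - 1 \<le> d"
    using card_mono[of "{x \<in> carrier R. x [^] d = \<one>}" "carrier R - {\<zero>}"]
      num_roots_le_deg[OF fin d0] fin by (simp add: card_Diff_singleton)
  moreover have "d dvd ?q - 1" by (simp add: d_def)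
  ultimately have "d = ?q - 1" using q by (simp add: dvd_imp_le le_antisym)
  then show ?R by (metis d_def gcd_dvd1)
qed

text \<open>When \<open>q\<close> is even the exponent \<open>q - 1\<close> is odd, whence \<open>1 = (-1)\<^sup>q\<^sup>-\<^sup>1 = -1\<close>.\<close>

lemma even_card_imp_char_two:
  assumes fin: "finite (carrier R)" and ev: "even (card (carrier R))"
  shows "\<one> \<oplus> \<one> = \<zero>"
proof -
  have "card (carrier R) > 0" using fin by (metis card_gt_0_iff one_closed empty_iff)
  then obtain m where m: "card (carrier R) - 1 = 2 * m + 1"
    using ev by (metis Suc_diff_1 Suc_eq_plus1 even_Suc oddE)
  have "\<ominus> \<one> \<in> carrier R - {\<zero>}"
    using local.minus_minus local.minus_zero
    by (metis DiffI a_inv_closed one_closed singletonD zero_not_one)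
  moreover have "(\<ominus> \<one>) [^] (2 * m + 1) = \<ominus> \<one>"
  proof -
    have "(\<ominus> \<one>) [^] (2::nat) = \<one>" by (simp add: numeral_2_eq_2 l_minus)
    then show ?thesis by (simp add: nat_pow_pow[symmetric])
  qed
  ultimately have "\<ominus> \<one> = \<one>" using pow_card_minus_one[OF fin, of "\<ominus> \<one>"] m by simp
  then show ?thesis by (metis l_neg one_closed)
qed

text \<open>Every element has additive order at most two, so by Sylow's theorem the order of the additive
  group has no odd prime factor.\<close>

lemma char_two_imp_card_power_of_two:
  assumes fin: "finite (carrier R)" and two: "\<one> \<oplus> \<one> = \<zero>"
  obtains t where "t \<ge> 1" "card (carrier R) = 2 ^ t"
proof -
  let ?q = "card (carrier R)"
  have dbl: "a \<oplus> a = \<zero>" if "a \<in> carrier R" for a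
    using that two by (metis l_distr l_null l_one one_closed)
  have "card {\<zero>, \<one>} \<le> ?q" by (intro card_mono fin) auto
  then have q: "?q \<ge> 2" by simp
  have "?q \<noteq> 0" "\<not> is_unit (2::nat)" using q by auto
  then obtain t m where tm: "?q = 2 ^ t * m" "odd m"
    by (rule multiplicity_decompose')
  have "m = 1"
  proof (rule ccontr)
    assume "m \<noteq> 1"
    then obtain p where p: "prime p" "p dvd m" using prime_factor_nat by blast
    then have podd: "odd p" using tm(2) by (meson dvd_trans)
    obtain r where r: "?q = p ^ 1 * r" using p(2) tm(1) by (metis dvd_def dvd_mult power_one_right)
    have grp: "group (add_monoid R)" by (rule add.is_group)
    have "\<exists>H. subgroup H (add_monoid R) \<and> card H = p ^ 1"
      using sylow_thm[OF p(1) grp, of 1 r] fin r by (simp add: order_def)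
    then obtain H where H: "subgroup H (add_monoid R)" "card H = p" by auto
    interpret HG: group "add_monoid R\<lparr>carrier := H\<rparr>"
      by (rule subgroup.subgroup_is_group[OF H(1) grp])
    have "card H \<ge> 2" using H(2) p(1) prime_ge_2_nat by simp
    then obtain h where h: "h \<in> H" "h \<noteq> \<zero>"
      by (metis card_2_iff' card_le_Suc0_iff_eq card.infinite not_less_eq_eq numeral_2_eq_2 zero_le)
    have hR: "h \<in> carrier R" using h(1) subgroup.subset[OF H(1)] by auto
    obtain c where c: "p = 2 * c + 1" using podd oddE by blast
    have "h [^]\<^bsub>add_monoid R\<lparr>carrier := H\<rparr>\<^esub> p = \<zero>"
      using HG.pow_order_eq_1[of h] h H(2) by (simp add: order_def)
    then have "h [^]\<^bsub>add_monoid R\<^esub> p = \<zero>" 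
      by (simp add: nat_pow_def)
    then have "[p] \<cdot> h = \<zero>" by (simp add: add_pow_def)
    moreover have "[p] \<cdot> h = h"
    proof -
      have "[(2::nat)] \<cdot> h = \<zero>"
        using hR dbl[OF hR] by (simp add: numeral_2_eq_2)
      then have "[(2 * c)] \<cdot> h = \<zero>"
        using add.nat_pow_pow[OF hR, of c 2] by (simp add: mult.commute)
      then show ?thesis unfolding c using hR by simp
    qed
    ultimately show False using h(2) by simp
  qed
  then have "t \<noteq> 0" using tm q by (intro notI) simp
  then show thesis using that[of t] tm(1) \<open>m = 1\<close> by simp
qed

lemma power_of_two_card_and_dvd_iff:
  fixes k :: nat
  assumes fin: "finite (carrier R)"
  shows "(\<exists>t\<ge>1. card (carrier R) = 2 ^ t \<and> (card (carrier R) - 1) dvd k) \<longleftrightarrow>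
    \<one> \<oplus> \<one> = \<zero> \<and> (\<forall>a \<in> carrier R - {\<zero>}. a [^] k = \<one>)" (is "?L \<longleftrightarrow> ?R")
proof
  assume ?L
  then obtain t where "t \<ge> 1" "card (carrier R) = 2 ^ t" "(card (carrier R) - 1) dvd k" by blast
  then show ?R
    using even_card_imp_char_two[OF fin] exponent_of_units[OF fin] by simp
next
  assume R: ?R
  then obtain t where "t \<ge> 1" "card (carrier R) = 2 ^ t"
    using char_two_imp_card_power_of_two[OF fin] by blast
  then show ?L using R exponent_of_units[OF fin] by auto
qed

end

section \<open>Cayley graphs of finite fields\<close>

lemma cayley_one_iso_copies_K2:
  fixes F (structure)
  assumes "field F" and fin: "finite (carrier F)" and card: "card (carrier F) = 2 * n"
  shows "digraph_iso (with_proj (cayley_digraph (add_monoid F) {\<one>}))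
           (with_proj (disjoint_copies n (complete_graph 2)))"
proof -
  interpret field F by fact
  have two: "\<one> \<oplus> \<one> = \<zero>" using even_card_imp_char_two[OF fin] card by simp
  have diff: "b \<ominus> a = \<one> \<longleftrightarrow> b = a \<oplus> \<one>" if "a \<in> carrier F" "b \<in> carrier F" for a b
    using that by (metis a_comm a_inv_closed add.inv_solve_right' minus_eq one_closed)
  have "cayley_digraph (add_monoid F) {\<one>}
      = \<lparr>pverts = carrier F, parcs = {(a, b). a \<in> carrier F \<and> b = a \<oplus> \<one>}\<rparr>"
    using diff by (auto simp: cayley_digraph_def a_inv_def[symmetric] minus_eq[symmetric])
  moreover have "a \<oplus> \<one> \<oplus> \<one> = a" if "a \<in> carrier F" for a
    using that two by (simp add: a_assoc)
  moreover have "a \<oplus> \<one> \<noteq> a" if "a \<in> carrier F" for a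
    using that by (metis add.l_cancel_one one_closed zero_not_one)
  ultimately show ?thesis
    using involution_digraph_iso_copies_K2[OF fin card, of "\<lambda>a. a \<oplus> \<one>"] by simp
qed

lemma image_constant_value:
  assumes "x \<in> A" and "\<And>y. y \<in> A \<Longrightarrow> f y = c"
  shows "f ` A = {c}"
  using assms by auto

text \<open>The connection set \<open>S\<close> is \<open>U\<close> for one graph and \<open>T\<close> for the other; the argument for both is the same.
The isomorphism with \<open>2\<^sup>t\<^sup>-\<^sup>1\<close> copies of \<open>K\<^sub>2\<close> forces the common vertex set to have \<open>2\<^sup>t\<close> elements. The
equation on the left compares fields of the same order, for which the chosen models coincide, and so
the connection sets can be compared by looking at the arcs that leave \<open>0\<close>.\<close>

lemma cayley_eq_gen_paley_iff:
  fixes q k t :: nat and S :: "nat set"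
  defines "F \<equiv> GF q"
  assumes F: "field F" "finite (carrier F)" "card (carrier F) = q"
    and S: "U_set F k \<subseteq> S" "S \<subseteq> T_set F k" and t: "1 \<le> t"
  shows "cayley_digraph (add_monoid F) S = gen_paley (2 ^ t - 1) (2 ^ t) \<and>
      digraph_iso (with_proj (gen_paley (2 ^ t - 1) (2 ^ t)))
        (with_proj (disjoint_copies (2 ^ (t - 1)) (complete_graph 2)))
    \<longleftrightarrow> q = 2 ^ t \<and> (q - 1) dvd k" (is "?G \<and> ?I \<longleftrightarrow> _")
proof -
  interpret F: field F by fact
  have exponent: "(q - 1) dvd k \<longleftrightarrow> (\<forall>a \<in> carrier F - {\<zero>\<^bsub>F\<^esub>}. a [^]\<^bsub>F\<^esub> k = \<one>\<^bsub>F\<^esub>)"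
    unfolding F(3)[symmetric] by (rule F.exponent_of_units[OF F(2), symmetric])
  have t2: "2 * 2 ^ (t - 1) = (2 ^ t :: nat)" using t by (cases t) auto
  have paley: "gen_paley (2 ^ t - 1) (2 ^ t) = cayley_digraph (add_monoid F) {\<one>\<^bsub>F\<^esub>}"
    if q: "q = 2 ^ t"
  proof -
    have "x [^]\<^bsub>F\<^esub> (q - 1) = \<one>\<^bsub>F\<^esub>" if "x \<in> carrier F - {\<zero>\<^bsub>F\<^esub>}" for x
      using F.pow_card_minus_one[OF F(2) that] F(3) by simp
    then have "{x [^]\<^bsub>F\<^esub> (q - 1) | x. x \<in> carrier F - {\<zero>\<^bsub>F\<^esub>}} = {\<one>\<^bsub>F\<^esub>}"
      unfolding Setcompr_eq_image by (intro image_constant_value[of "\<one>\<^bsub>F\<^esub>"]) simp_all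
    then show ?thesis unfolding gen_paley_def F_def q by (rule arg_cong)
  qed
  show ?thesis
  proof
    assume L: "?G \<and> ?I"
    have "carrier F = pverts (gen_paley (2 ^ t - 1) (2 ^ t))"
      using arg_cong[OF L[THEN conjunct1], of pverts] by (simp add: cayley_digraph_def)
    then have "card (carrier F) = card (pverts (gen_paley (2 ^ t - 1) (2 ^ t)))"
      by simp
    also have "\<dots> = card (pverts (disjoint_copies (2 ^ (t - 1)) (complete_graph 2)))"
      using digraph_iso_card_verts[OF L[THEN conjunct2]] by simp
    also have "\<dots> = 2 ^ t"
      using t2 by (simp add: disjoint_copies_def complete_graph_def card_cartesian_product mult.commute)
    finally have q: "q = 2 ^ t" using F(3) by simp
    have arc: "(\<zero>\<^bsub>F\<^esub>, b) \<in> parcs (cayley_digraph (add_monoid F) T) \<longleftrightarrow> b \<in> T"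
      if "b \<in> carrier F" for b T
      using that F.minus_zero unfolding a_inv_def by (simp add: cayley_digraph_def)
    have "a [^]\<^bsub>F\<^esub> k = \<one>\<^bsub>F\<^esub>" if a: "a \<in> carrier F - {\<zero>\<^bsub>F\<^esub>}" for a
    proof -
      have "a [^]\<^bsub>F\<^esub> k \<in> S" using S(1) a F.field_Units unfolding U_set_def by blast
      moreover have "a [^]\<^bsub>F\<^esub> k \<in> S \<longleftrightarrow> a [^]\<^bsub>F\<^esub> k \<in> {\<one>\<^bsub>F\<^esub>}"
        using L[THEN conjunct1, unfolded paley[OF q]] arc a
        by (metis DiffD1 F.nat_pow_closed)
      ultimately show ?thesis by simp
    qed
    then show "q = 2 ^ t \<and> (q - 1) dvd k"
      using exponent q by simp
  next
    assume R: "q = 2 ^ t \<and> (q - 1) dvd k"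
    then have pow: "a [^]\<^bsub>F\<^esub> k = \<one>\<^bsub>F\<^esub>" if "a \<in> carrier F - {\<zero>\<^bsub>F\<^esub>}" for a
      using exponent that by (metis (no_types))
    have "even (card (carrier F))" using R t F(3) by simp
    then have "\<ominus>\<^bsub>F\<^esub> \<one>\<^bsub>F\<^esub> = \<one>\<^bsub>F\<^esub>"
      using F.even_card_imp_char_two[OF F(2)] by (metis F.minus_equality F.one_closed)
    moreover have U: "U_set F k = {\<one>\<^bsub>F\<^esub>}"
      using pow F.field_Units unfolding U_set_def Setcompr_eq_image
      by (intro image_constant_value[of "\<one>\<^bsub>F\<^esub>"]) simp_all
    ultimately have "S = {\<one>\<^bsub>F\<^esub>}" using S by (auto simp: T_set_def)
    then show "?G \<and> ?I"
      using paley R cayley_one_iso_copies_K2[OF F(1,2), of "2 ^ (t - 1)"] F(3) t2 by simp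
  qed
qed

section \<open>Geometric sums in a ring\<close>

text \<open>The recursion exhibits consecutive partial sums, which will be the vertices of a walk, as differing by
a power of \<open>u\<close>.\<close>

primrec geometric_sum :: "('a, 'm) ring_scheme \<Rightarrow> 'a \<Rightarrow> nat \<Rightarrow> 'a" where
  "geometric_sum R u 0 = \<zero>\<^bsub>R\<^esub>"
| "geometric_sum R u (Suc n) = geometric_sum R u n \<oplus>\<^bsub>R\<^esub> u [^]\<^bsub>R\<^esub> n"

context ring begin

lemma geometric_sum_closed [simp]: "u \<in> carrier R \<Longrightarrow> geometric_sum R u n \<in> carrier R"
  by (induction n) auto

lemma geometric_sum_add:
  assumes "u \<in> carrier R"
  shows "geometric_sum R u (m + n) = geometric_sum R u m \<oplus> u [^] m \<otimes> geometric_sum R u n"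
  using assms by (induction n) (auto simp: r_distr a_assoc nat_pow_mult)

text \<open>This is what makes closed walks of different lengths in the factors of a product compatible.\<close>

lemma geometric_sum_mult_eq_zero:
  assumes u: "u \<in> carrier R" and "u [^] n = \<one>" and "geometric_sum R u n = \<zero>"
  shows "geometric_sum R u (n * l) = \<zero>"
  using assms(2,3) by (induction l) (auto simp: u geometric_sum_add)

lemma geometric_sum_telescope:
  assumes u: "u \<in> carrier R"
  shows "(u \<ominus> \<one>) \<otimes> geometric_sum R u n = u [^] n \<ominus> \<one>"
proof (induction n)
  case 0
  then show ?case using u by (simp add: minus_eq r_neg)
next
  case (Suc n)
  have p: "u [^] n \<in> carrier R" using u by simp
  have "(u \<ominus> \<one>) \<otimes> u [^] n = u \<otimes> u [^] n \<ominus> u [^] n"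
    using u p by (simp add: minus_eq l_distr l_minus)
  also have "u \<otimes> u [^] n = u [^] Suc n"
    using u by (metis nat_pow_Suc2)
  finally have "(u \<ominus> \<one>) \<otimes> geometric_sum R u (Suc n)
      = (u [^] n \<ominus> \<one>) \<oplus> (u [^] Suc n \<ominus> u [^] n)"
    using u p Suc by (simp add: r_distr)
  also have "\<dots> = (\<ominus> (u [^] n) \<oplus> u [^] n) \<oplus> (u [^] Suc n \<ominus> \<one>)"
    using u p by (simp add: minus_eq a_ac del: nat_pow_Suc)
  also have "\<dots> = u [^] Suc n \<ominus> \<one>"
    using u p by (simp add: l_neg)
  finally show ?case .
qed

end

lemma (in ring_hom_ring) hom_geometric_sum:
  assumes "u \<in> carrier R"
  shows "h (geometric_sum R u n) = geometric_sum S (h u) n"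
  using assms by (induction n) (auto simp: hom_nat_pow)

section \<open>Direct products of a list of rings\<close>

lemma RDirProd_list_Cons_add_mult:
  assumes "a \<in> carrier R" "b \<in> carrier R"
    "as \<in> carrier (RDirProd_list Rs)" "bs \<in> carrier (RDirProd_list Rs)"
  shows "(a # as) \<oplus>\<^bsub>RDirProd_list (R # Rs)\<^esub> (b # bs) = (a \<oplus>\<^bsub>R\<^esub> b) # (as \<oplus>\<^bsub>RDirProd_list Rs\<^esub> bs)"
    and "(a # as) \<otimes>\<^bsub>RDirProd_list (R # Rs)\<^esub> (b # bs) = (a \<otimes>\<^bsub>R\<^esub> b) # (as \<otimes>\<^bsub>RDirProd_list Rs\<^esub> bs)"
  using ring_iso_memE[OF RDirProd_list_iso1[of R Rs]] assms
  by (force simp: RDirProd_carrier RDirProd_def DirProd_def monoid.defs)+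

lemma RDirProd_list_nth_hom:
  assumes "i < length Rs"
  shows "(\<lambda>as. as ! i) \<in> ring_hom (RDirProd_list Rs) (Rs ! i)"
  using assms
proof (induction Rs arbitrary: i)
  case (Cons R Rs)
  have "as ! i \<in> carrier ((R # Rs) ! i)" if "as \<in> carrier (RDirProd_list (R # Rs))" for as
    using RDirProd_list_carrier_mem(2)[OF that Cons.prems] .
  moreover have "\<one>\<^bsub>RDirProd_list (R # Rs)\<^esub> ! i = \<one>\<^bsub>(R # Rs) ! i\<^esub>"
    using Cons ring_hom_one[OF Cons.IH] by (cases i) (auto simp: RDirProd_list_one)
  ultimately show ?case
    using Cons.prems ring_hom_add[OF Cons.IH] ring_hom_mult[OF Cons.IH]
    by (cases i) (auto intro!: ring_hom_memI simp: RDirProd_list_carrier RDirProd_list_Cons_add_mult)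
qed simp

lemma RDirProd_list_eqI:
  assumes "as \<in> carrier (RDirProd_list Rs)" "bs \<in> carrier (RDirProd_list Rs)"
    and "\<And>i. i < length Rs \<Longrightarrow> as ! i = bs ! i"
  shows "as = bs"
  using assms RDirProd_list_carrier_mem(1) by (metis nth_equalityI)

lemma RDirProd_list_UnitsI:
  assumes rings: "\<And>i. i < length Rs \<Longrightarrow> ring (Rs ! i)"
    and len: "length as = length Rs" and units: "\<And>i. i < length Rs \<Longrightarrow> as ! i \<in> Units (Rs ! i)"
  shows "as \<in> Units (RDirProd_list Rs)"
proof -
  let ?P = "RDirProd_list Rs"
  interpret P: ring ?P by (rule RDirProd_list_is_ring) (rule rings)
  define bs where "bs = map (\<lambda>i. inv\<^bsub>Rs ! i\<^esub> (as ! i)) [0..<length Rs]"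
  have as: "as \<in> carrier ?P"
    using units by (intro RDirProd_list_carrier_memI) (auto simp: len Units_def)
  have bs: "bs \<in> carrier ?P"
    using units rings by (intro RDirProd_list_carrier_memI)
      (auto simp: bs_def intro!: monoid.Units_inv_closed ring.is_monoid)
  have nth: "(cs \<otimes>\<^bsub>?P\<^esub> ds) ! i = cs ! i \<otimes>\<^bsub>Rs ! i\<^esub> ds ! i"
    if "i < length Rs" "cs \<in> carrier ?P" "ds \<in> carrier ?P" for i cs ds
    using ring_hom_mult[OF RDirProd_list_nth_hom[OF that(1)] that(2,3)] .
  have one: "\<one>\<^bsub>?P\<^esub> ! i = \<one>\<^bsub>Rs ! i\<^esub>" if "i < length Rs" for i
    using ring_hom_one[OF RDirProd_list_nth_hom[OF that]] .
  have "as \<otimes>\<^bsub>?P\<^esub> bs = \<one>\<^bsub>?P\<^esub>"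
  proof (rule RDirProd_list_eqI)
    fix i assume i: "i < length Rs"
    show "(as \<otimes>\<^bsub>?P\<^esub> bs) ! i = \<one>\<^bsub>?P\<^esub> ! i"
      using nth[OF i as bs] one[OF i] monoid.Units_r_inv[OF ring.is_monoid[OF rings[OF i]] units[OF i]] i
      by (simp add: bs_def)
  qed (use as bs in auto)
  moreover have "bs \<otimes>\<^bsub>?P\<^esub> as = \<one>\<^bsub>?P\<^esub>"
  proof (rule RDirProd_list_eqI)
    fix i assume i: "i < length Rs"
    show "(bs \<otimes>\<^bsub>?P\<^esub> as) ! i = \<one>\<^bsub>?P\<^esub> ! i"
      using nth[OF i bs as] one[OF i] monoid.Units_l_inv[OF ring.is_monoid[OF rings[OF i]] units[OF i]] i
      by (simp add: bs_def)
  qed (use as bs in auto)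
  ultimately show ?thesis
    using as bs unfolding Units_def by blast
qed

lemma RDirProd_list_nth_surj:
  assumes "\<And>i. i < length Rs \<Longrightarrow> ring (Rs ! i)" and "i < length Rs"
  shows "(\<lambda>as. as ! i) ` carrier (RDirProd_list Rs) = carrier (Rs ! i)"
proof
  show "(\<lambda>as. as ! i) ` carrier (RDirProd_list Rs) \<subseteq> carrier (Rs ! i)"
    using RDirProd_list_carrier_mem(2)[OF _ assms(2)] by auto
  show "carrier (Rs ! i) \<subseteq> (\<lambda>as. as ! i) ` carrier (RDirProd_list Rs)"
  proof
    fix a assume a: "a \<in> carrier (Rs ! i)"
    let ?as = "(map (\<lambda>R. \<zero>\<^bsub>R\<^esub>) Rs)[i := a]"
    have "?as ! j \<in> carrier (Rs ! j)" if "j < length Rs" for j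
      using a that ring.ring_simprules(2)[OF assms(1)[OF that]] by (cases "j = i") auto
    then have "?as \<in> carrier (RDirProd_list Rs)"
      by (intro RDirProd_list_carrier_memI) auto
    then show "a \<in> (\<lambda>as. as ! i) ` carrier (RDirProd_list Rs)"
      using assms(2) by (intro image_eqI[of _ _ ?as]) auto
  qed
qed

lemma finite_factor_of_RDirProd_list:
  assumes "finite (carrier R)" and "R \<simeq> RDirProd_list Rs"
    and "\<And>i. i < length Rs \<Longrightarrow> ring (Rs ! i)" and "i < length Rs"
  shows "finite (carrier (Rs ! i))"
proof -
  obtain \<phi> where "bij_betw \<phi> (carrier R) (carrier (RDirProd_list Rs))"
    using assms(2) by (auto simp: is_ring_iso_def ring_iso_def)
  then have "finite (carrier (RDirProd_list Rs))" using assms(1) bij_betw_finite by blast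
  then show ?thesis
    using RDirProd_list_nth_surj[of Rs i] assms(3,4) by (metis finite_imageI)
qed

lemma (in ring_hom_ring) hom_Units:
  assumes "x \<in> Units R"
  shows "h x \<in> Units S"
proof -
  obtain y where y: "x \<in> carrier R" "y \<in> carrier R" "x \<otimes> y = \<one>" "y \<otimes> x = \<one>"
    using assms unfolding Units_def by auto
  then have "h x \<otimes>\<^bsub>S\<^esub> h y = \<one>\<^bsub>S\<^esub>" "h y \<otimes>\<^bsub>S\<^esub> h x = \<one>\<^bsub>S\<^esub>"
    by (metis hom_mult hom_one)+
  then show ?thesis
    unfolding Units_def using y by auto
qed

section \<open>Finite local rings\<close>

lemma (in cring) finite_proper_ideal_in_maximal:
  assumes fin: "finite (carrier R)" and I: "ideal I R" "I \<noteq> carrier R"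
  obtains M where "maximalideal M R" "I \<subseteq> M"
proof -
  let ?S = "{J. ideal J R \<and> I \<subseteq> J \<and> J \<noteq> carrier R}"
  have sub: "J \<subseteq> carrier R" if "ideal J R" for J
    using ideal.Icarr[OF that] by blast
  have "finite ?S" using sub by (intro finite_subset[OF _ finite_Pow_iff[THEN iffD2, OF fin]]) auto
  moreover have "I \<in> ?S" using I by simp
  ultimately have "\<exists>M\<in>?S. I \<subseteq> M \<and> (\<forall>J\<in>?S. M \<subseteq> J \<longrightarrow> M = J)"
    by (rule finite_has_maximal2)
  then obtain M where M: "M \<in> ?S" "\<forall>J\<in>?S. M \<subseteq> J \<longrightarrow> M = J"
    by (elim bexE conjE)
  have "maximalideal M R"
  proof (rule maximalidealI)
    fix J assume J: "ideal J R" "M \<subseteq> J"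
    with M show "J = M \<or> J = carrier R" by (metis (mono_tags, lifting) mem_Collect_eq order_trans)
  qed (use M(1) in auto)
  then show thesis using that M(1) by simp
qed

text \<open>The principal ideal of a non-unit is proper, so it lies in some maximal ideal, and \<open>\<mm>\<close> is the
  only one.\<close>

lemma local_cring_UnitsI:
  fixes R (structure)
  assumes loc: "local_cring R \<mm>" and fin: "finite (carrier R)"
    and x: "x \<in> carrier R" "x \<notin> \<mm>"
  shows "x \<in> Units R"
proof (rule ccontr)
  assume nu: "x \<notin> Units R"
  interpret cring R using loc by (simp add: local_cring_def)
  have "\<one> \<notin> PIdl x"
    using nu x(1) m_comm unfolding cgenideal_def Units_def by auto
  then have "PIdl x \<noteq> carrier R" by auto
  then obtain M where "maximalideal M R" "PIdl x \<subseteq> M"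
    using finite_proper_ideal_in_maximal[OF fin cgenideal_ideal[OF x(1)]] by blast
  then show False
    using loc x cgenideal_self[OF x(1)] unfolding local_cring_def by blast
qed

lemma local_cring_residue_field:
  assumes "local_cring R \<mm>" and fin: "finite (carrier R)"
  shows "field (R Quot \<mm>)" and "finite (carrier (R Quot \<mm>))"
proof -
  show "field (R Quot \<mm>)"
    using assms(1) by (simp add: local_cring_def maximalideal.quotient_is_field)
  show "finite (carrier (R Quot \<mm>))"
    using fin by (simp add: FactRing_def A_RCOSETS_def')
qed

text \<open>Here \<open>geometric_sum R \<one> n\<close> is the multiple \<open>n \<cdot> 1\<close>. The additive order of \<open>1\<close> is odd, since an even
  one could be halved by cancelling the unit \<open>2\<close>.\<close>

lemma (in cring) two_unit_imp_odd_multiple_zero: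
  assumes fin: "finite (carrier R)" and two: "\<one> \<oplus> \<one> \<in> Units R"
  obtains n where "odd n" "geometric_sum R \<one> n = \<zero>"
proof -
  have eq: "geometric_sum R \<one> n = [n] \<cdot> \<one>" for n :: nat
    by (induction n) (auto)
  define P where "P n \<longleftrightarrow> n > 0 \<and> geometric_sum R \<one> n = \<zero>" for n
  have "P (card (carrier R))"
    using add.pow_order_eq_1[of \<one>] fin unfolding P_def eq
    by (auto simp: order_def add_pow_def card_gt_0_iff)
  then obtain n where n: "P n" and least: "\<And>m. P m \<Longrightarrow> n \<le> m"
    by (metis LeastI Least_le)
  have "odd n"
  proof
    assume "even n"
    then obtain m where m: "n = m + m" by (metis evenE mult_2)
    have "(\<one> \<oplus> \<one>) \<otimes> geometric_sum R \<one> m = \<zero>"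
      using n unfolding m P_def by (simp add: geometric_sum_add l_distr)
    then have "geometric_sum R \<one> m = \<zero>"
      using two by (metis Units_closed Units_l_cancel geometric_sum_closed one_closed r_null zero_closed)
    then have "P m" using n unfolding m P_def by simp
    then show False using least n unfolding P_def m by fastforce
  qed
  then show thesis using that n unfolding P_def by blast
qed

text \<open>If \<open>2 \<noteq> 0\<close> in \<open>K\<close>, then \<open>2\<close> is a unit of \<open>R\<close> and \<open>u = 1\<close> works. Otherwise take a unit \<open>y\<close> whose power
\<open>y\<^sup>k\<close> does not map to \<open>1\<close> in \<open>K\<close>, write the order of the unit group as \<open>2\<^sup>a n\<close> with \<open>n\<close> odd, and let \<open>u\<close> be
the result of squaring \<open>y\<^sup>k\<close> \<open>a\<close> times. Then \<open>u\<^sup>n = 1\<close>, and since squaring is injective in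
characteristic two, \<open>u\<close> still does not map to \<open>1\<close>. Hence \<open>u - 1\<close> is a unit, and \<open>(u - 1) (1 + u + \<dots> + u\<^sup>n\<^sup>-\<^sup>1) = u\<^sup>n - 1 = 0\<close> makes the sum vanish.\<close>

lemma odd_vanishing_geometric_sum:
  fixes R (structure) and K (structure) and k :: nat
  assumes hom: "ring_hom_ring R K h" and "cring R" and "field K" and fin: "finite (carrier R)"
    and lift: "\<And>x. x \<in> carrier R \<Longrightarrow> h x \<noteq> \<zero>\<^bsub>K\<^esub> \<Longrightarrow> x \<in> Units R"
    and nontriv: "\<one>\<^bsub>K\<^esub> \<oplus>\<^bsub>K\<^esub> \<one>\<^bsub>K\<^esub> \<noteq> \<zero>\<^bsub>K\<^esub> \<or>
      (\<exists>y \<in> carrier R. h y \<noteq> \<zero>\<^bsub>K\<^esub> \<and> h y [^]\<^bsub>K\<^esub> k \<noteq> \<one>\<^bsub>K\<^esub>)"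
  shows "\<exists>x \<in> Units R. \<exists>n. odd n \<and> (x [^] k) [^] n = \<one> \<and> geometric_sum R (x [^] k) n = \<zero>"
proof -
  interpret R: cring R by fact
  interpret K: field K by fact
  interpret h: ring_hom_ring R K h by fact
  show ?thesis
  proof (cases "\<one>\<^bsub>K\<^esub> \<oplus>\<^bsub>K\<^esub> \<one>\<^bsub>K\<^esub> = \<zero>\<^bsub>K\<^esub>")
    case False
    then have "\<one> \<oplus> \<one> \<in> Units R" by (intro lift) auto
    then obtain n where "odd n" "geometric_sum R \<one> n = \<zero>"
      using R.two_unit_imp_odd_multiple_zero[OF fin] by blast
    then show ?thesis by (intro bexI[of _ \<one>] exI[of _ n]) auto
  next
    case two: True
    then obtain y where y: "y \<in> carrier R" "h y \<noteq> \<zero>\<^bsub>K\<^esub>" "h y [^]\<^bsub>K\<^esub> k \<noteq> \<one>\<^bsub>K\<^esub>"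
      using nontriv by blast
    then have yU: "y \<in> Units R" by (intro lift)
    define v where "v = y [^] k"
    have v: "v \<in> Units R" "v \<in> carrier R" "h v \<noteq> \<one>\<^bsub>K\<^esub>"
      using yU y by (auto simp: v_def R.Units_pow_closed h.hom_nat_pow)
    have "finite (Units R)" using fin by blast
    then have "card (Units R) \<noteq> 0" "\<not> is_unit (2::nat)" using yU by auto
    then obtain a n where M: "card (Units R) = 2 ^ a * n" "odd n"
      by (rule multiplicity_decompose')
    define u where "u = v [^] (2 ^ a :: nat)"
    have u: "u \<in> Units R" "u \<in> carrier R" using v by (auto simp: u_def R.Units_pow_closed)
    have dbl: "b \<oplus>\<^bsub>K\<^esub> b = \<zero>\<^bsub>K\<^esub>" if "b \<in> carrier K" for b
      using that two by (metis K.l_distr K.l_null K.l_one K.one_closed)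
    have sq: "b = \<one>\<^bsub>K\<^esub>" if "b \<in> carrier K" "b \<otimes>\<^bsub>K\<^esub> b = \<one>\<^bsub>K\<^esub>" for b
      using K.square_eq_one[OF that] dbl by (metis K.minus_equality K.one_closed)
    \<comment> \<open>Repeated squaring never reaches \<open>1\<close> in \<open>K\<close> unless it starts there.\<close>
    have "h v [^]\<^bsub>K\<^esub> (2 ^ j :: nat) \<noteq> \<one>\<^bsub>K\<^esub>" for j
    proof (induction j)
      case 0
      then show ?case using v by simp
    next
      case (Suc j)
      have "h v [^]\<^bsub>K\<^esub> (2 ^ Suc j :: nat)
          = h v [^]\<^bsub>K\<^esub> (2 ^ j :: nat) \<otimes>\<^bsub>K\<^esub> h v [^]\<^bsub>K\<^esub> (2 ^ j :: nat)"
        using v by (simp add: K.nat_pow_mult mult_2)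
      then show ?case using Suc sq[of "h v [^]\<^bsub>K\<^esub> (2 ^ j :: nat)"] v by auto
    qed
    then have hu: "h u \<noteq> \<one>\<^bsub>K\<^esub>" using v by (simp add: u_def h.hom_nat_pow)
    have "h (u \<ominus> \<one>) = h u \<ominus>\<^bsub>K\<^esub> \<one>\<^bsub>K\<^esub>"
      using u by (simp add: R.minus_eq K.minus_eq)
    then have "u \<ominus> \<one> \<in> Units R"
      using u hu by (intro lift) (auto simp: K.r_right_minus_eq)
    moreover have un: "u [^] n = \<one>"
      using R.units_power_order_eq_one[OF \<open>finite (Units R)\<close> v(1)] v M(1)
      by (simp add: u_def R.nat_pow_pow)
    then have "(u \<ominus> \<one>) \<otimes> geometric_sum R u n = \<zero>"
      using R.geometric_sum_telescope[OF u(2)] by (simp add: R.minus_eq R.r_neg)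
    ultimately have "geometric_sum R u n = \<zero>"
      using u by (metis R.Units_l_cancel R.geometric_sum_closed R.r_null R.zero_closed R.Units_closed)
    moreover have "u = (y [^] (2 ^ a :: nat)) [^] k"
      using y(1) by (simp add: u_def v_def R.nat_pow_pow mult.commute)
    moreover have "y [^] (2 ^ a :: nat) \<in> Units R"
      using yU by (rule R.Units_pow_closed)
    ultimately show ?thesis
      using un M(2) by metis
  qed
qed

section \<open>Bipartite unit graphs\<close>

lemma bipartiteI:
  assumes "parcs G \<subseteq> pverts G \<times> pverts G" and "\<And>v w. (v, w) \<in> parcs G \<Longrightarrow> w \<in> C \<longleftrightarrow> v \<notin> C"
  shows "bipartite G"
  unfolding bipartite_def
  using assms by (intro exI[of _ "pverts G \<inter> C"] exI[of _ "pverts G - C"]) auto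

lemma bipartiteE:
  assumes "bipartite G"
  obtains C where "\<And>v w. (v, w) \<in> parcs G \<Longrightarrow> w \<in> C \<longleftrightarrow> v \<notin> C"
proof -
  obtain V1 V2 where V: "V1 \<inter> V2 = {}" "parcs G \<subseteq> V1 \<times> V2 \<union> V2 \<times> V1"
    using assms unfolding bipartite_def by blast
  show thesis by (rule that[of V1]) (use V in blast)
qed

lemma (in ring) arc_G_graph_iff:
  "(v, w) \<in> parcs (G_graph R k) \<longleftrightarrow> v \<in> carrier R \<and> w \<in> carrier R \<and> w \<ominus> v \<in> U_set R k"
  by (auto simp: G_graph_def cayley_digraph_def minus_eq a_inv_def)

lemma (in ring) bipartite_GT_graph_iff: "bipartite (GT_graph R k) \<longleftrightarrow> bipartite (G_graph R k)"
proof -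
  have "w \<ominus> v \<in> T_set R k \<longleftrightarrow> w \<ominus> v \<in> U_set R k \<or> v \<ominus> w \<in> U_set R k"
    if "v \<in> carrier R" "w \<in> carrier R" for v w
  proof -
    have neg: "\<ominus> (w \<ominus> v) = v \<ominus> w" "\<ominus> (v \<ominus> w) = w \<ominus> v"
      using that by (simp_all add: minus_eq minus_add a_comm)
    have "U_set R k \<subseteq> carrier R" by (auto simp: U_set_def)
    then have "w \<ominus> v \<in> {\<ominus> u | u. u \<in> U_set R k} \<longleftrightarrow> v \<ominus> w \<in> U_set R k"
      using neg by (smt (verit) mem_Collect_eq minus_minus subsetD)
    then show ?thesis
      unfolding T_set_def by blast
  qed
  then have "parcs (GT_graph R k) = parcs (G_graph R k) \<union> (parcs (G_graph R k))\<inverse>"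
    unfolding GT_graph_def G_graph_def cayley_digraph_def
    by (auto simp: minus_eq[unfolded a_inv_def])
  moreover have "pverts (GT_graph R k) = pverts (G_graph R k)"
    by (simp add: GT_graph_def G_graph_def cayley_digraph_def)
  moreover have "E \<union> E\<inverse> \<subseteq> V \<times> W \<union> W \<times> V \<longleftrightarrow> E \<subseteq> V \<times> W \<union> W \<times> V"
    for E :: "('a \<times> 'a) set" and V W
    by auto
  ultimately show ?thesis unfolding bipartite_def by simp
qed

text \<open>The partial sums are the vertices of a directed walk, along which colours alternate; after \<open>n\<close> steps
  it is back at \<open>0\<close>.\<close>

lemma (in cring) not_bipartite_if_odd_geometric_sum:
  assumes x: "x \<in> Units R" and n: "odd n" and zero: "geometric_sum R (x [^] k) n = \<zero>"
  shows "\<not> bipartite (G_graph R k)"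
proof
  assume "bipartite (G_graph R k)"
  then obtain C where C: "\<And>v w. (v, w) \<in> parcs (G_graph R k) \<Longrightarrow> w \<in> C \<longleftrightarrow> v \<notin> C"
    by (rule bipartiteE) blast
  define u where "u = x [^] k"
  have u: "u \<in> carrier R" using x by (simp add: u_def Units_closed)
  have "u [^] j \<in> U_set R k" for j :: nat
  proof -
    have "u [^] j = (x [^] j) [^] k"
      using x by (simp add: u_def nat_pow_pow mult.commute Units_closed)
    then show ?thesis using x unfolding U_set_def by (auto intro: Units_pow_closed)
  qed
  moreover have "(a \<oplus> b) \<ominus> a = b" if "a \<in> carrier R" "b \<in> carrier R" for a b
    using that by (metis a_comm a_inv_closed minus_eq r_neg2 add.m_closed)
  ultimately have "(geometric_sum R u j, geometric_sum R u (Suc j)) \<in> parcs (G_graph R k)" for j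
    using u by (simp add: arc_G_graph_iff)
  from C[OF this] have step: "geometric_sum R u (Suc j) \<in> C \<longleftrightarrow> geometric_sum R u j \<notin> C" for j .
  have "geometric_sum R u j \<in> C \<longleftrightarrow> (even j \<longleftrightarrow> \<zero> \<in> C)" for j
  proof (induction j)
    case (Suc j)
    then show ?case using step[of j] by auto
  qed simp
  from this[of n] show False using n zero by (simp add: u_def)
qed

text \<open>Under \<open>h\<close> every arc of the graph becomes a step \<open>a \<mapsto> a + 1\<close>, which is a fixed-point-free involution of
  \<open>K\<close>; a transversal of its orbits is one colour class of \<open>K\<close> and is pulled back along \<open>h\<close>.\<close>

lemma bipartite_if_hom_to_char_two_field:
  fixes R (structure) and K (structure) and k :: nat
  assumes "ring_hom_ring R K h" and "field K" and two: "\<one>\<^bsub>K\<^esub> \<oplus>\<^bsub>K\<^esub> \<one>\<^bsub>K\<^esub> = \<zero>\<^bsub>K\<^esub>"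
    and triv: "\<And>a. a \<in> carrier K \<Longrightarrow> a \<noteq> \<zero>\<^bsub>K\<^esub> \<Longrightarrow> a [^]\<^bsub>K\<^esub> k = \<one>\<^bsub>K\<^esub>"
  shows "bipartite (G_graph R k)"
proof -
  interpret K: field K by fact
  interpret h: ring_hom_ring R K h by fact
  let ?\<sigma> = "\<lambda>a. a \<oplus>\<^bsub>K\<^esub> \<one>\<^bsub>K\<^esub>"
  have inv: "?\<sigma> (?\<sigma> a) = a" and free: "?\<sigma> a \<noteq> a" if "a \<in> carrier K" for a
  proof -
    show "?\<sigma> (?\<sigma> a) = a" using that two by (simp add: K.a_assoc)
    show "?\<sigma> a \<noteq> a" using that by (metis K.add.l_cancel_one' K.one_closed K.zero_not_one
      K.add.r_cancel_one')
  qed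
  obtain C where C: "C \<subseteq> carrier K" "\<And>a. a \<in> carrier K \<Longrightarrow> ?\<sigma> a \<in> C \<longleftrightarrow> a \<notin> C"
    by (rule involution_transversal[of "carrier K" ?\<sigma>]) (use inv free in auto)
  show ?thesis
  proof (rule bipartiteI[of _ "h -` C"])
    show "parcs (G_graph R k) \<subseteq> pverts (G_graph R k) \<times> pverts (G_graph R k)"
      by (auto simp: G_graph_def cayley_digraph_def)
    fix v w assume "(v, w) \<in> parcs (G_graph R k)"
    then have vw: "v \<in> carrier R" "w \<in> carrier R" "w \<ominus> v \<in> U_set R k"
      by (simp_all add: h.R.arc_G_graph_iff)
    then obtain x where x: "x \<in> Units R" "w \<ominus> v = x [^] k"
      by (auto simp: U_set_def)
    then have "h x \<in> Units K" by (intro h.hom_Units)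
    then have "h (w \<ominus> v) = \<one>\<^bsub>K\<^esub>"
      using triv[of "h x"] x by (auto simp: h.hom_nat_pow K.field_Units h.R.Units_closed)
    moreover have "w = v \<oplus> (w \<ominus> v)"
      using vw by (metis h.R.minus_eq h.R.a_lcomm h.R.r_neg h.R.r_zero h.R.a_inv_closed)
    then have "h w = h v \<oplus>\<^bsub>K\<^esub> h (w \<ominus> v)"
      using vw by (metis h.R.minus_closed h.hom_add)
    ultimately show "w \<in> h -` C \<longleftrightarrow> v \<notin> h -` C" using C(2)[of "h v"] vw by simp
  qed
qed

lemma bipartite_G_graph_iff:
  fixes R :: "('a, 'm) ring_scheme" and Rs :: "('b, 'n) ring_scheme list" and k :: nat
  assumes R: "cring R" "finite (carrier R)" and iso: "R \<simeq> RDirProd_list Rs"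
    and loc: "\<And>i. i < length Rs \<Longrightarrow> local_cring (Rs ! i) (\<mm> i)"
  shows "bipartite (G_graph R k) \<longleftrightarrow> (\<exists>i<length Rs. \<exists>t\<ge>1.
      card (carrier ((Rs ! i) Quot (\<mm> i))) = 2 ^ t \<and>
      (card (carrier ((Rs ! i) Quot (\<mm> i))) - 1) dvd k)"
proof -
  let ?P = "RDirProd_list Rs" and ?K = "\<lambda>i. (Rs ! i) Quot (\<mm> i)"
  define \<rho> where "\<rho> i = a_r_coset (Rs ! i) (\<mm> i)" for i
  have cr: "cring (Rs ! i)" and max: "maximalideal (\<mm> i) (Rs ! i)" if "i < length Rs" for i
    using loc[OF that] by (auto simp: local_cring_def)
  have ring: "ring (Rs ! i)" if "i < length Rs" for i
    using cr[OF that] by (rule cring.axioms)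
  interpret R: cring R by fact
  interpret P: ring ?P by (rule RDirProd_list_is_ring) (rule ring)
  obtain \<phi> where \<phi>: "\<phi> \<in> ring_iso R ?P" using iso by (auto simp: is_ring_iso_def)
  have \<phi>hom: "\<phi> \<in> ring_hom R ?P" using \<phi> by (auto simp: ring_iso_def)
  have fin: "finite (carrier (Rs ! i))" if "i < length Rs" for i
    using finite_factor_of_RDirProd_list[OF R(2) iso ring that] .
  have K: "field (?K i)" and finK: "finite (carrier (?K i))" if "i < length Rs" for i
    using local_cring_residue_field[OF loc[OF that] fin[OF that]] by simp_all
  have ideal: "ideal (\<mm> i) (Rs ! i)" if "i < length Rs" for i
    using max[OF that] by (rule maximalideal.axioms)
  have \<rho>hom: "ring_hom_ring (Rs ! i) (?K i) (\<rho> i)" if "i < length Rs" for i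
    unfolding \<rho>_def using ideal.rcos_ring_hom_ring[OF ideal[OF that]] .
  have \<rho>surj: "\<rho> i ` carrier (Rs ! i) = carrier (?K i)" for i
    by (auto simp: \<rho>_def FactRing_def A_RCOSETS_def')
  have lift: "x \<in> Units (Rs ! i)"
    if i: "i < length Rs" and x: "x \<in> carrier (Rs ! i)" "\<rho> i x \<noteq> \<zero>\<^bsub>?K i\<^esub>" for i x
  proof (rule local_cring_UnitsI[OF loc[OF i] fin[OF i] x(1)])
    show "x \<notin> \<mm> i"
      using x ring.a_rcos_zero[OF ring[OF i] ideal[OF i]] by (auto simp: \<rho>_def FactRing_def)
  qed
  let ?good = "\<lambda>i. \<exists>t\<ge>1. card (carrier (?K i)) = 2 ^ t \<and> (card (carrier (?K i)) - 1) dvd k"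
  have good_iff: "?good i \<longleftrightarrow> \<one>\<^bsub>?K i\<^esub> \<oplus>\<^bsub>?K i\<^esub> \<one>\<^bsub>?K i\<^esub> = \<zero>\<^bsub>?K i\<^esub> \<and>
      (\<forall>a \<in> carrier (?K i) - {\<zero>\<^bsub>?K i\<^esub>}. a [^]\<^bsub>?K i\<^esub> k = \<one>\<^bsub>?K i\<^esub>)" if "i < length Rs" for i
    by (rule field.power_of_two_card_and_dvd_iff[OF K[OF that] finK[OF that]])
  show "bipartite (G_graph R k) \<longleftrightarrow> (\<exists>i<length Rs. ?good i)"
  proof
    assume "\<exists>i<length Rs. ?good i"
    then obtain i where i: "i < length Rs" and good: "?good i" by blast
    interpret K: field "?K i" by (rule K[OF i])
    have "(\<rho> i \<circ> (\<lambda>as. as ! i)) \<circ> \<phi> \<in> ring_hom R (?K i)"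
      using ring_hom_trans[OF \<phi>hom ring_hom_trans[OF RDirProd_list_nth_hom[OF i]
            ring_hom_ring.homh[OF \<rho>hom[OF i]]]] .
    then have "ring_hom_ring R (?K i) ((\<rho> i \<circ> (\<lambda>as. as ! i)) \<circ> \<phi>)"
      by (intro ring_hom_ringI2) (simp_all add: R.ring_axioms K.ring_axioms)
    then show "bipartite (G_graph R k)"
      by (rule bipartite_if_hom_to_char_two_field[OF _ K[OF i]])
        (use good good_iff[OF i] in auto)
  next
    assume bip: "bipartite (G_graph R k)"
    show "\<exists>i<length Rs. ?good i"
    proof (rule ccontr)
      assume not_good: "\<not> (\<exists>i<length Rs. ?good i)"
      have "\<exists>x \<in> Units (Rs ! i). \<exists>n. odd n \<and> (x [^]\<^bsub>Rs ! i\<^esub> k) [^]\<^bsub>Rs ! i\<^esub> n = \<one>\<^bsub>Rs ! i\<^esub>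
          \<and> geometric_sum (Rs ! i) (x [^]\<^bsub>Rs ! i\<^esub> k) n = \<zero>\<^bsub>Rs ! i\<^esub>" if i: "i < length Rs" for i
      proof (rule odd_vanishing_geometric_sum[OF \<rho>hom[OF i] cr[OF i] K[OF i] fin[OF i] lift[OF i]])
        have "\<not> ?good i" using not_good i by blast
        then consider (odd) "\<one>\<^bsub>?K i\<^esub> \<oplus>\<^bsub>?K i\<^esub> \<one>\<^bsub>?K i\<^esub> \<noteq> \<zero>\<^bsub>?K i\<^esub>"
          | (power) a where "a \<in> carrier (?K i)" "a \<noteq> \<zero>\<^bsub>?K i\<^esub>" "a [^]\<^bsub>?K i\<^esub> k \<noteq> \<one>\<^bsub>?K i\<^esub>"
          unfolding good_iff[OF i] by auto
        then show "\<one>\<^bsub>?K i\<^esub> \<oplus>\<^bsub>?K i\<^esub> \<one>\<^bsub>?K i\<^esub> \<noteq> \<zero>\<^bsub>?K i\<^esub> \<or>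
            (\<exists>y \<in> carrier (Rs ! i). \<rho> i y \<noteq> \<zero>\<^bsub>?K i\<^esub> \<and> \<rho> i y [^]\<^bsub>?K i\<^esub> k \<noteq> \<one>\<^bsub>?K i\<^esub>)"
        proof cases
          case power
          then obtain y where "y \<in> carrier (Rs ! i)" "a = \<rho> i y"
            using \<rho>surj[of i] by (metis imageE)
          then show ?thesis using power by blast
        qed blast
      qed
      then obtain x n where x: "\<And>i. i < length Rs \<Longrightarrow> x i \<in> Units (Rs ! i)"
        and n: "\<And>i. i < length Rs \<Longrightarrow> odd (n i)"
        and pow: "\<And>i. i < length Rs \<Longrightarrow>
          (x i [^]\<^bsub>Rs ! i\<^esub> k) [^]\<^bsub>Rs ! i\<^esub> (n i :: nat) = \<one>\<^bsub>Rs ! i\<^esub>"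
        and zero: "\<And>i. i < length Rs \<Longrightarrow>
          geometric_sum (Rs ! i) (x i [^]\<^bsub>Rs ! i\<^esub> k) (n i) = \<zero>\<^bsub>Rs ! i\<^esub>"
        by metis
      \<comment> \<open>A common odd length at which the geometric sums vanish in every factor.\<close>
      define N where "N = (\<Prod>i<length Rs. n i)"
      have "odd N" using n by (simp add: N_def even_prod_iff)
      define X where "X = map x [0..<length Rs]"
      have X: "X \<in> Units ?P"
        by (rule RDirProd_list_UnitsI[OF ring]) (auto simp: X_def x)
      have "geometric_sum ?P (X [^]\<^bsub>?P\<^esub> k) N = \<zero>\<^bsub>?P\<^esub>"
      proof (rule RDirProd_list_eqI)
        fix i assume i: "i < length Rs"
        interpret Ri: ring "Rs ! i" by (rule ring[OF i])
        interpret p: ring_hom_ring ?P "Rs ! i" "\<lambda>as. as ! i"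
          by (intro ring_hom_ringI2 P.ring_axioms Ri.ring_axioms RDirProd_list_nth_hom i)
        obtain l where "N = n i * l"
          using i unfolding N_def by (metis dvd_def dvd_prodI finite_lessThan lessThan_iff)
        moreover have "x i [^]\<^bsub>Rs ! i\<^esub> k \<in> carrier (Rs ! i)"
          using x[OF i] by (simp add: Ri.Units_closed)
        ultimately have "geometric_sum (Rs ! i) (x i [^]\<^bsub>Rs ! i\<^esub> k) N = \<zero>\<^bsub>Rs ! i\<^esub>"
          using Ri.geometric_sum_mult_eq_zero[OF _ pow[OF i] zero[OF i]] by simp
        then show "geometric_sum ?P (X [^]\<^bsub>?P\<^esub> k) N ! i = \<zero>\<^bsub>?P\<^esub> ! i"
          using X i by (simp add: p.hom_geometric_sum p.hom_nat_pow P.Units_closed X_def)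
      qed (use X in \<open>simp_all add: P.Units_closed\<close>)
      moreover
      obtain \<psi> where "\<psi> \<in> ring_iso ?P R"
        using ring_iso_set_sym[OF R.ring_axioms \<phi>] by blast
      then interpret \<psi>: ring_hom_ring ?P R \<psi>
        by (intro ring_hom_ringI2 P.ring_axioms R.ring_axioms) (simp add: ring_iso_def)
      have "geometric_sum R (\<psi> X [^]\<^bsub>R\<^esub> k) N = \<psi> (geometric_sum ?P (X [^]\<^bsub>?P\<^esub> k) N)"
        using X by (simp add: \<psi>.hom_geometric_sum \<psi>.hom_nat_pow P.Units_closed)
      ultimately have "geometric_sum R (\<psi> X [^]\<^bsub>R\<^esub> k) N = \<zero>\<^bsub>R\<^esub>"
        by simp
      then show False
        using R.not_bipartite_if_odd_geometric_sum[OF \<psi>.hom_Units[OF X] \<open>odd N\<close>] bip by blast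
    qed
  qed
qed

theorem theorem8p5:
  fixes R :: "('a, 'm) ring_scheme"
    and Rs :: "('b, 'n) ring_scheme list"
    and \<mm> :: "nat \<Rightarrow> 'b set"
    and q :: "nat \<Rightarrow> nat"
    and s k :: nat
  assumes "cring R" and "finite (carrier R)"
    and "s = length Rs" and "1 \<le> s"
    and "R \<simeq> RDirProd_list Rs"
    and "\<forall>i<s. local_cring (Rs ! i) (\<mm> i)"
    and "\<forall>i<s. q i = card (carrier ((Rs ! i) Quot (\<mm> i)))"
    and "\<forall>i<s. (Rs ! i) Quot (\<mm> i) \<simeq> GF (q i)"
    and "1 \<le> k" and "gcd k (card (carrier R)) = 1"
  shows
    "((bipartite (G_graph R k) \<longleftrightarrow>
        (\<exists>i<s. \<exists>t\<ge>1.
           G_graph (GF (q i)) k = gen_paley (2 ^ t - 1) (2 ^ t) \<and>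
           digraph_iso (with_proj (gen_paley (2 ^ t - 1) (2 ^ t)))
             (with_proj (disjoint_copies (2 ^ (t - 1)) (complete_graph 2))))) \<and>
      (\<forall>i<s. \<forall>t\<ge>1.
         G_graph (GF (q i)) k = gen_paley (2 ^ t - 1) (2 ^ t) \<and>
         digraph_iso (with_proj (gen_paley (2 ^ t - 1) (2 ^ t)))
           (with_proj (disjoint_copies (2 ^ (t - 1)) (complete_graph 2))) \<longrightarrow>
         q i = 2 ^ t \<and> gcd k (q i - 1) = 2 ^ t - 1)) \<and>
     (card {j. j < s \<and> \<ominus>\<^bsub>Rs ! j\<^esub> \<one>\<^bsub>Rs ! j\<^esub> \<notin> U_set (Rs ! j) k} \<le> 1 \<longrightarrow>
      (bipartite (GT_graph R k) \<longleftrightarrow>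
        (\<exists>i<s. \<exists>t\<ge>1.
           GT_graph (GF (q i)) k = gen_paley (2 ^ t - 1) (2 ^ t) \<and>
           digraph_iso (with_proj (gen_paley (2 ^ t - 1) (2 ^ t)))
             (with_proj (disjoint_copies (2 ^ (t - 1)) (complete_graph 2))))) \<and>
      (\<forall>i<s. \<forall>t\<ge>1.
         GT_graph (GF (q i)) k = gen_paley (2 ^ t - 1) (2 ^ t) \<and>
         digraph_iso (with_proj (gen_paley (2 ^ t - 1) (2 ^ t)))
           (with_proj (disjoint_copies (2 ^ (t - 1)) (complete_graph 2))) \<longrightarrow>
         q i = 2 ^ t \<and> gcd k (q i - 1) = 2 ^ t - 1))"
proof -
  have loc: "local_cring (Rs ! i) (\<mm> i)" if "i < length Rs" for i
    using assms(3,6) that by blast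
  have rings: "ring (Rs ! i)" if "i < length Rs" for i
    using loc[OF that] by (simp add: local_cring_def cring.axioms(1))
  note K = local_cring_residue_field[OF loc finite_factor_of_RDirProd_list[OF assms(2,5) rings]]
  have q: "q i = card (carrier ((Rs ! i) Quot (\<mm> i)))" if "i < s" for i
    using assms(7) that by blast
  \<comment> \<open>The residue field witnesses that a field with \<open>q i\<close> elements exists, so the chosen model is one.\<close>
  have F: "field (GF (q i))" "finite (carrier (GF (q i)))" "card (carrier (GF (q i))) = q i"
    if "i < s" for i
    using GF_field[OF K] that q[OF that] assms(3) by simp_all
  have G: "G_graph (GF (q i)) k = gen_paley (2 ^ t - 1) (2 ^ t) \<and>
      digraph_iso (with_proj (gen_paley (2 ^ t - 1) (2 ^ t)))
        (with_proj (disjoint_copies (2 ^ (t - 1)) (complete_graph 2)))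
    \<longleftrightarrow> q i = 2 ^ t \<and> (q i - 1) dvd k" if "i < s" "1 \<le> t" for i t
    unfolding G_graph_def
    by (rule cayley_eq_gen_paley_iff[OF F[OF that(1)] _ _ that(2)]) (auto simp: T_set_def)
  have GT: "GT_graph (GF (q i)) k = gen_paley (2 ^ t - 1) (2 ^ t) \<and>
      digraph_iso (with_proj (gen_paley (2 ^ t - 1) (2 ^ t)))
        (with_proj (disjoint_copies (2 ^ (t - 1)) (complete_graph 2)))
    \<longleftrightarrow> q i = 2 ^ t \<and> (q i - 1) dvd k" if "i < s" "1 \<le> t" for i t
    unfolding GT_graph_def
    by (rule cayley_eq_gen_paley_iff[OF F[OF that(1)] _ _ that(2)]) (auto simp: T_set_def)
  have bip: "bipartite (G_graph R k) \<longleftrightarrow> (\<exists>i<s. \<exists>t\<ge>1. q i = 2 ^ t \<and> (q i - 1) dvd k)"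
    using bipartite_G_graph_iff[OF assms(1,2,5) loc, of k] q assms(3) by (metis (no_types, lifting))
  have gcd: "gcd k (q i - 1) = 2 ^ t - 1" if "q i = 2 ^ t \<and> (q i - 1) dvd k" for i t
    using that by (metis gcd_nat.absorb2)
  note bipT = ring.bipartite_GT_graph_iff[OF cring.axioms(1)[OF assms(1)], of k]
  show ?thesis
    unfolding bipT bip using G GT gcd by (intro conjI impI) (metis (no_types, lifting))+
qed

end
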